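(* For every $\alpha\in(0,1)$ there exists a constant $\lambda=\lambda(\alpha)>0$ such that the following holds. Let $G_\alpha$ be any graph on the vertex set $[n]$ with minimum degree $\delta(G_\alpha)\ge \alpha n$, and let $p=p(n)$ satisfy $\frac{1}{n^2}\ll p \ll \frac1n$. Then with high probability the randomly perturbed graph $H=G_\alpha\cup G(n,p)$ has the property that for every coloring $\chi:E(H)\to\{+1,-1\}$ there is a spanning tree $T$ of $H$ with \[ \Bigl|\sum_{e\in E(T)}\chi(e)\Bigr| \ge \lambda p n^2 . \]
   Context: $G(n,p)$ is the binomial random graph on the same vertex set $[n]$, each pair joined independently with probability $p$, and $H=G_\alpha\cup G(n,p)$ is the graph on $[n]$ whose edge set is the union of the two edge sets. $\frac{1}{n^2}\ll p\ll\frac1n$ means $pn^2\to\infty$ and $pn\to 0$ as $n\to\infty$. "With high probability" means with probability tending to $1$ as $n\to\infty$. *)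

theory Defs
  imports "HOL-Probability.Probability"
begin

text \<open>A simple graph is given by its vertex set and its set of edges, each edge being a
  two-element set of vertices.\<close>

definition all_pairs :: "'a set \<Rightarrow> 'a set set" where
  "all_pairs V = {e. e \<subseteq> V \<and> card e = 2}"

definition simple_graph :: "'a set \<Rightarrow> 'a set set \<Rightarrow> bool" where
  "simple_graph V E \<longleftrightarrow> finite V \<and> E \<subseteq> all_pairs V"

definition vertex_degree :: "'a set set \<Rightarrow> 'a \<Rightarrow> nat" where
  "vertex_degree E v = card {e \<in> E. v \<in> e}"

text \<open>Only meaningful for finite nonempty \<open>V\<close>, because of \<open>Min\<close>.\<close>

definition min_degree :: "'a set \<Rightarrow> 'a set set \<Rightarrow> nat" where
  "min_degree V E = Min (vertex_degree E ` V)"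

definition connected_graph :: "'a set \<Rightarrow> 'a set set \<Rightarrow> bool" where
  "connected_graph V E \<longleftrightarrow>
     V \<noteq> {} \<and> (\<forall>u\<in>V. \<forall>v\<in>V. (u, v) \<in> {(x, y). {x, y} \<in> E}\<^sup>*)"

text \<open>A cycle is the list of its vertices in cyclic order, without repeating the first one.\<close>

definition is_cycle :: "'a set set \<Rightarrow> 'a list \<Rightarrow> bool" where
  "is_cycle E vs \<longleftrightarrow> length vs \<ge> 3 \<and> distinct vs \<and>
     (\<forall>i<length vs. {vs ! i, vs ! (Suc i mod length vs)} \<in> E)"

definition is_tree :: "'a set \<Rightarrow> 'a set set \<Rightarrow> bool" where
  "is_tree V T \<longleftrightarrow> simple_graph V T \<and> connected_graph V T \<and> (\<nexists>vs. is_cycle T vs)"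

definition spanning_tree :: "'a set \<Rightarrow> 'a set set \<Rightarrow> 'a set set \<Rightarrow> bool" where
  "spanning_tree V E T \<longleftrightarrow> T \<subseteq> E \<and> is_tree V T"

text \<open>The distribution of the edge set of \<open>G(n,p)\<close> on the vertex set \<open>{1..n}\<close>;
  as \<open>bernoulli_pmf\<close> does, it presupposes \<open>0 \<le> p \<le> 1\<close>.\<close>

definition gnp :: "nat \<Rightarrow> real \<Rightarrow> nat set set pmf" where
  "gnp n p =
     map_pmf (\<lambda>X. {e \<in> all_pairs {1..n}. X e})
       (Pi_pmf (all_pairs {1..n}) False (\<lambda>_. bernoulli_pmf p))"

end

theory Submission
  imports Defs
begin

text \<open>A spanning tree extending a maximal red forest has colour sum at least \<open>n + 1 - 2c\<close>, where
  \<open>c\<close> is the number of red components; the same holds for blue. Every vertex has a red or a blue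
  component of size at least \<open>\<alpha>n/2\<close>, and there are at most \<open>2/\<alpha>\<close> such large components of each
  colour. Hence, if all spanning trees have sum below \<open>D\<close> in absolute value, the set \<open>A\<close> of vertices
  in no large blue component and the set \<open>B\<close> of vertices in no large red component both have size
  about \<open>n/2\<close>, miss at most \<open>D + 4/\<alpha>\<close> vertices altogether, and no edge of \<open>H\<close> joins them.

  There are too many pairs \<open>(A, B)\<close> for a direct union bound. However, since no edge of the dense
  graph joins \<open>A\<close> to \<open>B\<close>, the pair is determined up to few vertices by its trace on a fixed set \<open>S\<close>
  of \<open>O(D)\<close> vertices in which almost every vertex has more than \<open>D + 4/\<alpha>\<close> neighbours. A Chernoff
  bound then beats the \<open>4^|S|\<close> traces when \<open>D = \<lambda>pn\<^sup>2\<close> with \<open>\<lambda>\<close> small; the uncertain vertices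
  meet few random edges because \<open>G(n,p)\<close> is nearly a matching for \<open>p \<ll> 1/n\<close>.\<close>

subsection \<open>Components and spanning forests\<close>

text \<open>The relation lives on the whole type, so it is an equivalence and every vertex, isolated
  or not, has a class. The classes of the vertices in \<open>V\<close> are the components.\<close>

definition conn :: "'a set set \<Rightarrow> 'a rel" where
  "conn E = {(x, y). {x, y} \<in> E}\<^sup>*"

definition comps :: "'a set \<Rightarrow> 'a set set \<Rightarrow> 'a set set" where
  "comps V E = (\<lambda>x. conn E `` {x}) ` V"

lemma conn_refl [simp]: "(x, x) \<in> conn E"
  by (simp add: conn_def)

lemma conn_sym: "(x, y) \<in> conn E \<Longrightarrow> (y, x) \<in> conn E"
proof -
  have "sym {(x, y). {x, y} \<in> E}"
    by (auto simp: sym_def insert_commute)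
  then show "(x, y) \<in> conn E \<Longrightarrow> (y, x) \<in> conn E"
    unfolding conn_def by (metis sym_rtrancl symD)
qed

lemma conn_trans: "(x, y) \<in> conn E \<Longrightarrow> (y, z) \<in> conn E \<Longrightarrow> (x, z) \<in> conn E"
  by (simp add: conn_def)

lemma conn_edge: "{x, y} \<in> E \<Longrightarrow> (x, y) \<in> conn E"
  by (auto simp: conn_def)

lemma conn_subset:
  assumes "\<And>x y. {x, y} \<in> E \<Longrightarrow> (x, y) \<in> conn F"
  shows "conn E \<subseteq> conn F"
proof -
  have "{(x, y). {x, y} \<in> E} \<subseteq> {(x, y). {x, y} \<in> F}\<^sup>*"
    using assms by (auto simp: conn_def)
  then show ?thesis
    unfolding conn_def by (rule rtrancl_subset_rtrancl)
qed

lemma conn_mono: "E \<subseteq> F \<Longrightarrow> conn E \<subseteq> conn F"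
  by (rule conn_subset) (auto intro: conn_edge)

lemma conn_class_eq_iff: "conn E `` {x} = conn E `` {y} \<longleftrightarrow> (x, y) \<in> conn E"
  by (auto intro: conn_sym conn_trans)

lemma conn_empty: "conn {} = Id"
  by (simp add: conn_def)

lemma conn_class_subset:
  assumes "E \<subseteq> all_pairs V" "x \<in> V"
  shows "conn E `` {x} \<subseteq> V"
proof -
  have "y \<in> V" if "(x, y) \<in> conn E" for y
    using that unfolding conn_def
    by (induction rule: rtrancl_induct) (use assms in \<open>auto simp: all_pairs_def\<close>)
  then show ?thesis by auto
qed

lemma conn_insert_redundant:
  assumes "(a, b) \<in> conn E"
  shows "conn (insert {a, b} E) = conn E"
proof
  show "conn (insert {a, b} E) \<subseteq> conn E"
    by (rule conn_subset) (use assms in \<open>auto simp: doubleton_eq_iff intro: conn_edge conn_sym\<close>)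
qed (rule conn_mono, auto)

text \<open>A path through the new edge may be taken to use it once, in one of two directions: in
  the induction a repeated use is absorbed by symmetry and transitivity of
  \<open>conn E\<close>.\<close>

lemma conn_insert_iff:
  "(x, y) \<in> conn (insert {a, b} E) \<longleftrightarrow>
     (x, y) \<in> conn E \<or> (x, a) \<in> conn E \<and> (b, y) \<in> conn E \<or> (x, b) \<in> conn E \<and> (a, y) \<in> conn E"
proof
  assume "(x, y) \<in> conn (insert {a, b} E)"
  then show "(x, y) \<in> conn E \<or> (x, a) \<in> conn E \<and> (b, y) \<in> conn E \<or> (x, b) \<in> conn E \<and> (a, y) \<in> conn E"
    unfolding conn_def[of "insert {a, b} E"]
  proof (induction rule: rtrancl_induct)
    case (step y z)
    then consider "{y, z} \<in> E" | "y = a" "z = b" | "y = b" "z = a"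
      by (auto simp: doubleton_eq_iff)
    then show ?case
    proof cases
      case 1
      then show ?thesis using step.IH by (blast intro: conn_edge conn_trans)
    next
      case 2
      then show ?thesis using step.IH by (auto intro: conn_trans conn_sym)
    next
      case 3
      then show ?thesis using step.IH by (auto intro: conn_trans conn_sym)
    qed
  qed auto
next
  have m: "conn E \<subseteq> conn (insert {a, b} E)" by (rule conn_mono) auto
  have "(a, b) \<in> conn (insert {a, b} E)" by (rule conn_edge) auto
  moreover note conn_sym[OF this]
  moreover assume "(x, y) \<in> conn E \<or> (x, a) \<in> conn E \<and> (b, y) \<in> conn E \<or> (x, b) \<in> conn E \<and> (a, y) \<in> conn E"
  ultimately show "(x, y) \<in> conn (insert {a, b} E)"
    using m by (meson conn_trans subsetD)
qed

text \<open>The new edge merges the classes of \<open>a\<close> and \<open>b\<close>, which are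
  distinct by assumption, and leaves every other class as it is.\<close>

lemma card_comps_insert:
  assumes "finite V" "a \<in> V" "b \<in> V" "(a, b) \<notin> conn E"
  shows "Suc (card (comps V (insert {a, b} E))) = card (comps V E)"
proof -
  let ?A = "conn E `` {a}" and ?B = "conn E `` {b}"
  have cl: "conn (insert {a, b} E) `` {x} = (if x \<in> ?A \<union> ?B then ?A \<union> ?B else conn E `` {x})" for x
  proof (rule set_eqI)
    fix y
    show "y \<in> conn (insert {a, b} E) `` {x} \<longleftrightarrow>
        y \<in> (if x \<in> ?A \<union> ?B then ?A \<union> ?B else conn E `` {x})"
      by (simp add: conn_insert_iff) (meson conn_sym conn_trans)
  qed
  have 1: "comps V (insert {a, b} E) = insert (?A \<union> ?B) (comps V E - {?A, ?B})"
  proof (rule set_eqI)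
    fix C
    show "C \<in> comps V (insert {a, b} E) \<longleftrightarrow> C \<in> insert (?A \<union> ?B) (comps V E - {?A, ?B})"
    proof
      assume "C \<in> comps V (insert {a, b} E)"
      then obtain x where "x \<in> V" "C = conn (insert {a, b} E) `` {x}" by (auto simp: comps_def)
      then show "C \<in> insert (?A \<union> ?B) (comps V E - {?A, ?B})"
        by (auto simp: cl comps_def conn_class_eq_iff dest: conn_sym)
    next
      assume "C \<in> insert (?A \<union> ?B) (comps V E - {?A, ?B})"
      then show "C \<in> comps V (insert {a, b} E)"
      proof
        assume "C = ?A \<union> ?B"
        then have "C = conn (insert {a, b} E) `` {a}" by (simp add: cl)
        then show ?thesis using assms by (auto simp: comps_def)
      next
        assume *: "C \<in> comps V E - {?A, ?B}"
        then obtain x where x: "x \<in> V" "C = conn E `` {x}" by (auto simp: comps_def)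
        with * have "x \<notin> ?A \<union> ?B" by (auto simp: conn_class_eq_iff dest: conn_sym)
        then have "C = conn (insert {a, b} E) `` {x}" using x by (simp add: cl)
        then show ?thesis using x by (auto simp: comps_def)
      qed
    qed
  qed
  have fin: "finite (comps V E)" using assms by (simp add: comps_def)
  have ne: "?A \<noteq> ?B" using assms by (simp add: conn_class_eq_iff)
  have mem: "?A \<in> comps V E" "?B \<in> comps V E" using assms by (auto simp: comps_def)
  have notin: "?A \<union> ?B \<notin> comps V E - {?A, ?B}"
  proof
    assume "?A \<union> ?B \<in> comps V E - {?A, ?B}"
    then obtain x where x: "?A \<union> ?B = conn E `` {x}" by (auto simp: comps_def)
    have "a \<in> conn E `` {x}" "b \<in> conn E `` {x}" unfolding x[symmetric] by auto
    then have "(x, a) \<in> conn E" "(x, b) \<in> conn E" by auto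
    then show False using assms(4) by (meson conn_sym conn_trans)
  qed
  \<comment> \<open>This guards the truncated subtraction below: two classes disappear and one new
    class appears.\<close>
  have "card {?A, ?B} \<le> card (comps V E)" using fin mem by (intro card_mono) auto
  moreover have "card (comps V E - {?A, ?B}) = card (comps V E) - card {?A, ?B}"
    using mem by (intro card_Diff_subset) auto
  ultimately show ?thesis
    using ne notin fin by (simp add: 1)
qed

section \<open>Edge counts, forests and spanning trees\<close>

lemma finite_all_pairs: "finite V \<Longrightarrow> finite (all_pairs V)"
  by (rule finite_subset[of _ "Pow V"]) (auto simp: all_pairs_def)

lemma all_pairsE:
  assumes "e \<in> all_pairs V"
  obtains x y where "e = {x, y}" "x \<noteq> y" "x \<in> V" "y \<in> V"
  using assms by (auto simp: all_pairs_def card_2_iff)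

lemma card_comps_empty: "card (comps V {}) = card V"
  unfolding comps_def conn_empty by (rule card_image) (auto intro: inj_onI)

text \<open>There are \<open>card V\<close> components without edges, and each added edge lowers
  their number by at most one.\<close>

lemma card_le_edges_plus_comps:
  assumes "finite V" "F \<subseteq> all_pairs V"
  shows "card V \<le> card F + card (comps V F)"
proof -
  have "finite F" using assms finite_all_pairs finite_subset by blast
  then show ?thesis using assms(2)
  proof (induction F rule: finite_induct)
    case empty
    then show ?case by (simp add: card_comps_empty)
  next
    case (insert e F)
    obtain a b where ab: "e = {a, b}" "a \<in> V" "b \<in> V"
      using insert.prems by (auto elim: all_pairsE)
    show ?case
    proof (cases "(a, b) \<in> conn F")
      case True
      then have "comps V (insert e F) = comps V F"
        by (simp add: comps_def ab conn_insert_redundant)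
      then show ?thesis using insert by simp
    next
      case False
      then show ?thesis
        using card_comps_insert[OF assms(1) ab(2,3) False] insert ab(1) by simp
    qed
  qed
qed

text \<open>The equality case of \<open>card_le_edges_plus_comps\<close>. Encoding acyclicity by
  counting gives the sizes of forests and trees at once; the absence of cycles is derived from
  it.\<close>

definition forest_on :: "'a set \<Rightarrow> 'a set set \<Rightarrow> bool" where
  "forest_on V F \<longleftrightarrow> F \<subseteq> all_pairs V \<and> card F + card (comps V F) = card V"

text \<open>Deleting one edge of a cycle keeps all components, so equality for \<open>F\<close>
  would violate the general inequality for the smaller edge set.\<close>

lemma forest_on_no_cycle:
  assumes V: "finite V" and F: "forest_on V F"
  shows "\<not> is_cycle F vs"
proof
  assume cyc: "is_cycle F vs"
  define m where "m = length vs - 1"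
  have m: "length vs = Suc m" "2 \<le> m" and dist: "distinct vs"
    using cyc by (auto simp: m_def is_cycle_def)
  define e where "e = {vs ! 0, vs ! m}"
  have "e \<in> F"
    using cyc m by (auto simp: is_cycle_def e_def insert_commute dest!: spec[of _ m])
  have path: "(vs ! 0, vs ! i) \<in> conn (F - {e})" if "i \<le> m" for i
    using that
  proof (induction i)
    case (Suc i)
    have "{vs ! i, vs ! Suc i} \<in> F"
      using cyc m Suc.prems by (auto simp: is_cycle_def dest!: spec[of _ i])
    \<comment> \<open>Equality would force \<open>i = 0\<close> and \<open>Suc i = m\<close>, which
      \<open>m \<ge> 2\<close> excludes.\<close>
    moreover have "{vs ! i, vs ! Suc i} \<noteq> e"
      using Suc.prems m dist by (auto simp: e_def doubleton_eq_iff nth_eq_iff_index_eq)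
    ultimately show ?case
      using Suc by (auto intro: conn_edge conn_trans)
  qed auto
  have "conn (insert e (F - {e})) = conn (F - {e})"
    unfolding e_def by (rule conn_insert_redundant) (use path[of m] in \<open>simp add: e_def\<close>)
  then have "comps V F = comps V (F - {e})"
    using \<open>e \<in> F\<close> by (simp add: comps_def insert_absorb)
  moreover have "card V \<le> card (F - {e}) + card (comps V (F - {e}))"
    by (rule card_le_edges_plus_comps) (use V F in \<open>auto simp: forest_on_def\<close>)
  moreover have "card (F - {e}) < card F"
    using \<open>e \<in> F\<close> F V finite_all_pairs[OF V] finite_subset
    by (intro psubset_card_mono) (auto simp: forest_on_def)
  ultimately show False
    using F by (simp add: forest_on_def)
qed

text \<open>Take a forest of maximal size between \<open>F\<close> and \<open>E\<close>. An edge of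
  \<open>E\<close> joining two of its components could be added, since it raises the edge count and
  lowers the component count by one.\<close>

lemma forest_extend:
  assumes V: "finite V" and E: "E \<subseteq> all_pairs V" and F: "forest_on V F" "F \<subseteq> E"
  obtains T where "F \<subseteq> T" "T \<subseteq> E" "forest_on V T" "conn T = conn E"
proof -
  let ?P = "\<lambda>T. F \<subseteq> T \<and> T \<subseteq> E \<and> forest_on V T"
  have finE: "finite E" using V E finite_all_pairs finite_subset by blast
  have "\<exists>T. ?P T \<and> (\<forall>T'. ?P T' \<longrightarrow> card T' \<le> card T)"
    by (rule ex_has_greatest_nat[of ?P F _ "Suc (card E)"])
      (use F finE in \<open>auto intro: card_mono simp: less_Suc_eq_le\<close>)
  then obtain T where T: "?P T" and max: "\<And>T'. ?P T' \<Longrightarrow> card T' \<le> card T" by blast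
  have finT: "finite T" using T finE finite_subset by blast
  have "(x, y) \<in> conn T" if xy: "{x, y} \<in> E" for x y
  proof (rule ccontr)
    assume nc: "(x, y) \<notin> conn T"
    then have "{x, y} \<notin> T" by (auto intro: conn_edge)
    have "x \<in> V" "y \<in> V" using xy E by (auto simp: all_pairs_def)
    then have "Suc (card (comps V (insert {x, y} T))) = card (comps V T)"
      by (rule card_comps_insert[OF V _ _ nc])
    then have "?P (insert {x, y} T)"
      using T xy E finT \<open>{x, y} \<notin> T\<close> by (auto simp: forest_on_def)
    from max[OF this] show False using finT \<open>{x, y} \<notin> T\<close> by simp
  qed
  then have "conn E \<subseteq> conn T" by (rule conn_subset)
  moreover have "conn T \<subseteq> conn E" using T by (simp add: conn_mono)
  ultimately show thesis using T that by blast
qed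

lemma connected_graph_iff_conn: "connected_graph V E \<longleftrightarrow> V \<noteq> {} \<and> V \<times> V \<subseteq> conn E"
  by (auto simp: connected_graph_def conn_def)

text \<open>With \<open>c\<close> components of colour 1, a maximal forest of that colour has
  \<open>n - c\<close> edges. Extending it to a spanning tree adds \<open>c - 1\<close> edges worth
  at least -1 each, for a total of at least \<open>n + 1 - 2c\<close>.\<close>

lemma spanning_tree_with_large_sum:
  fixes col :: "'a set \<Rightarrow> int"
  assumes V: "finite V" and E: "E \<subseteq> all_pairs V" and c: "connected_graph V E"
    and col: "\<And>e. e \<in> E \<Longrightarrow> col e \<in> {1, -1}"
  obtains T where "spanning_tree V E T"
    "(\<Sum>e\<in>T. col e) \<ge> int (card V) + 1 - 2 * int (card (comps V {e \<in> E. col e = 1}))"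
proof -
  let ?E1 = "{e \<in> E. col e = 1}"
  have f0: "forest_on V {}" by (simp add: forest_on_def card_comps_empty)
  have E1: "?E1 \<subseteq> all_pairs V" using E by auto
  obtain F where "{} \<subseteq> F" and F: "F \<subseteq> ?E1" "forest_on V F" "conn F = conn ?E1"
    by (rule forest_extend[OF V E1 f0 empty_subsetI])
  have FE: "F \<subseteq> E" using F by auto
  obtain T where T: "F \<subseteq> T" "T \<subseteq> E" "forest_on V T" "conn T = conn E"
    by (rule forest_extend[OF V E F(2) FE])
  have "connected_graph V T" using c T by (simp add: connected_graph_iff_conn)
  then have st: "spanning_tree V E T"
    using T V E forest_on_no_cycle[OF V T(3)]
    by (auto simp: spanning_tree_def is_tree_def simple_graph_def)
  have finT: "finite T" using T E V finite_all_pairs finite_subset by (metis subset_trans)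
  have "comps V T = {V}"
    using c T conn_class_subset[OF E] by (auto simp: comps_def connected_graph_iff_conn image_iff) blast+
  then have cT: "card T + 1 = card V" using T by (simp add: forest_on_def)
  have cF: "card F + card (comps V ?E1) = card V"
    using F by (simp add: forest_on_def comps_def)
  have "(\<Sum>e\<in>T. col e) = (\<Sum>e\<in>F. col e) + (\<Sum>e\<in>T - F. col e)"
    using T finT by (metis add.commute sum.subset_diff)
  moreover have "(\<Sum>e\<in>F. col e) = int (card F)"
    using F by (simp add: subset_iff)
  moreover have "(\<Sum>e\<in>T - F. col e) \<ge> (\<Sum>e\<in>T - F. -1)"
    by (rule sum_mono) (use col T in fastforce)
  moreover have "card (T - F) + card F = card T"
    using T finT card_mono finite_subset by (metis add.commute card_Diff_subset le_add_diff_inverse)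
  ultimately have "(\<Sum>e\<in>T. col e) \<ge> int (card V) + 1 - 2 * int (card (comps V ?E1))"
    using cT cF by simp
  with st show thesis using that by blast
qed

text \<open>Components with at least \<open>d\<close> vertices are disjoint, so there are at most
  \<open>card V / d\<close> of them. Every other component is the class of a vertex counted in the
  last term.\<close>

lemma card_comps_le:
  assumes V: "finite V" and E: "E \<subseteq> all_pairs V" and d: "d > 0"
  shows "real (card (comps V E)) \<le>
    real (card V) / d + real (card {v \<in> V. real (card (conn E `` {v})) < d})"
proof -
  let ?S = "{v \<in> V. real (card (conn E `` {v})) < d}"
  define L where "L = {C \<in> comps V E. d \<le> real (card C)}"
  have finL: "finite L" using V by (simp add: L_def comps_def)
  have LV: "C \<subseteq> V" if "C \<in> L" for C
    using that conn_class_subset[OF E] by (auto simp: L_def comps_def)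
  have "pairwise disjnt L"
  proof (rule pairwiseI)
    fix C D assume "C \<in> L" "D \<in> L" "C \<noteq> D"
    then obtain x y where "C = conn E `` {x}" "D = conn E `` {y}" by (auto simp: L_def comps_def)
    with \<open>C \<noteq> D\<close> show "disjnt C D"
      by (auto simp: disjnt_def) (metis conn_sym conn_trans)+
  qed
  then have "card (\<Union>L) = sum card L"
    using LV V by (intro card_Union_disjoint) (auto intro: finite_subset)
  then have "real (sum card L) \<le> card V"
    using LV V by (metis Sup_least card_mono of_nat_le_iff)
  moreover have "d * real (card L) \<le> real (sum card L)"
    using sum_mono[of L "\<lambda>_. d" "\<lambda>C. real (card C)"] by (simp add: L_def mult.commute)
  ultimately have 1: "real (card L) \<le> real (card V) / d"
    using d by (simp add: field_simps)
  have "comps V E \<subseteq> L \<union> (\<lambda>v. conn E `` {v}) ` ?S"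
    by (auto simp: L_def comps_def)
  then have "card (comps V E) \<le> card (L \<union> (\<lambda>v. conn E `` {v}) ` ?S)"
    using V finL by (intro card_mono) auto
  also have "\<dots> \<le> card L + card ((\<lambda>v. conn E `` {v}) ` ?S)" by (rule card_Un_le)
  also have "\<dots> \<le> card L + card ?S" using V by (simp add: card_image_le)
  finally show ?thesis using 1 by linarith
qed

subsection \<open>Discrepancy from crossing edges\<close>

definition nbrs :: "'a set set \<Rightarrow> 'a \<Rightarrow> 'a set" where
  "nbrs E v = {u. {v, u} \<in> E}"

lemma vertex_degree_eq_card_nbrs:
  assumes "E \<subseteq> all_pairs V"
  shows "vertex_degree E v = card (nbrs E v)"
proof -
  have "bij_betw (\<lambda>u. {v, u}) (nbrs E v) {e \<in> E. v \<in> e}"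
    unfolding bij_betw_def
  proof
    show "inj_on (\<lambda>u. {v, u}) (nbrs E v)"
      by (auto simp: inj_on_def doubleton_eq_iff)
    show "(\<lambda>u. {v, u}) ` nbrs E v = {e \<in> E. v \<in> e}"
    proof
      show "{e \<in> E. v \<in> e} \<subseteq> (\<lambda>u. {v, u}) ` nbrs E v"
      proof
        fix e assume e: "e \<in> {e \<in> E. v \<in> e}"
        with assms have "e \<in> all_pairs V" by auto
        then obtain x y where "e = {x, y}" by (rule all_pairsE)
        with e have "e = {v, x} \<or> e = {v, y}" by auto
        with e show "e \<in> (\<lambda>u. {v, u}) ` nbrs E v" by (auto simp: nbrs_def)
      qed
    qed (auto simp: nbrs_def)
  qed
  then show ?thesis
    by (simp add: vertex_degree_def bij_betw_same_card)
qed

lemma nbrs_subset: "E \<subseteq> all_pairs V \<Longrightarrow> nbrs E v \<subseteq> V"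
  by (auto simp: nbrs_def all_pairs_def)

lemma nbrs_subset_conn_class: "nbrs E v \<subseteq> conn E `` {v}"
  by (auto simp: nbrs_def intro: conn_edge)

text \<open>A component and its complement each contain a full neighbourhood, hence at least
  \<open>d\<close> vertices, so \<open>cross\<close> yields an edge leaving the component.\<close>

lemma connected_if_crossing:
  assumes V: "finite V" "V \<noteq> {}" and E: "E \<subseteq> all_pairs V"
    and deg: "\<And>v. v \<in> V \<Longrightarrow> d \<le> real (card (nbrs E v))"
    and cross: "\<And>A B. \<lbrakk>A \<subseteq> V; B \<subseteq> V; A \<inter> B = {}; A \<union> B = V; d \<le> real (card A); d \<le> real (card B)\<rbrakk>
      \<Longrightarrow> \<exists>a\<in>A. \<exists>b\<in>B. {a, b} \<in> E"
  shows "connected_graph V E"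
proof (rule ccontr)
  assume "\<not> connected_graph V E"
  then obtain u v where uv: "u \<in> V" "v \<in> V" "(u, v) \<notin> conn E"
    using V by (auto simp: connected_graph_iff_conn)
  let ?A = "conn E `` {u}"
  have AV: "?A \<subseteq> V" using conn_class_subset[OF E] uv by simp
  have "nbrs E v \<subseteq> V - ?A"
  proof
    fix y assume "y \<in> nbrs E v"
    then have "(y, v) \<in> conn E" by (auto simp: nbrs_def intro: conn_edge conn_sym)
    then have "(u, y) \<notin> conn E" using uv(3) conn_trans by fast
    then show "y \<in> V - ?A" using \<open>y \<in> nbrs E v\<close> nbrs_subset[OF E] by auto
  qed
  then have "card (nbrs E v) \<le> card (V - ?A)" using V by (intro card_mono) auto
  moreover have "card (nbrs E u) \<le> card ?A"
    using AV V finite_subset by (intro card_mono nbrs_subset_conn_class) auto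
  ultimately have "d \<le> real (card ?A)" "d \<le> real (card (V - ?A))"
    using deg[OF uv(1)] deg[OF uv(2)] by linarith+
  with cross[of ?A "V - ?A"] AV obtain a b where
    "a \<in> ?A" "b \<in> V - ?A" "{a, b} \<in> E" by auto
  then show False using conn_trans[OF _ conn_edge, of u a E b] by auto
qed

text \<open>Vertices whose red class is small and vertices whose blue class is small span no edge
  between them; if both colour classes have about \<open>n/2\<close> components, these two sets
  cover almost everything.\<close>

lemma discrepancy_of_crossing:
  fixes col :: "'a set \<Rightarrow> int" and \<alpha> D :: real
  assumes V: "finite V" "V \<noteq> {}" and E: "E \<subseteq> all_pairs V" and \<alpha>: "0 < \<alpha>" "\<alpha> < 1"
    and deg: "\<And>v. v \<in> V \<Longrightarrow> \<alpha> * real (card V) \<le> real (card (nbrs E v))"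
    and D: "0 \<le> D" "D + 4 / \<alpha> \<le> real (card V) / 3"
    and cross: "\<And>A B. \<lbrakk>A \<subseteq> V; B \<subseteq> V; A \<inter> B = {}; \<alpha> * real (card V) / 3 \<le> real (card A);
        \<alpha> * real (card V) / 3 \<le> real (card B); real (card (V - A - B)) \<le> D + 4 / \<alpha>\<rbrakk>
      \<Longrightarrow> \<exists>a\<in>A. \<exists>b\<in>B. {a, b} \<in> E"
    and col: "\<And>e. e \<in> E \<Longrightarrow> col e \<in> {1, -1}"
  shows "\<exists>T. spanning_tree V E T \<and> \<bar>real_of_int (\<Sum>e\<in>T. col e)\<bar> \<ge> D"
proof (rule ccontr)
  assume contr: "\<not> ?thesis"
  define n where "n = real (card V)"
  have n: "n > 0" using V by (simp add: n_def card_gt_0_iff)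
  \<comment> \<open>\<open>?E2\<close> is written through \<open>- col\<close> so that the spanning
    tree bound can be applied to the negated colouring.\<close>
  let ?E1 = "{e \<in> E. col e = 1}" and ?E2 = "{e \<in> E. - col e = 1}"
  have con: "connected_graph V E"
  proof (rule connected_if_crossing[OF V E, of "\<alpha> * n"])
    fix A B assume AB: "A \<subseteq> V" "B \<subseteq> V" "A \<inter> B = {}" "A \<union> B = V"
      "\<alpha> * n \<le> real (card A)" "\<alpha> * n \<le> real (card B)"
    have "V - A - B = {}" using AB by auto
    then have "real (card (V - A - B)) \<le> D + 4 / \<alpha>" using D \<alpha> by (simp only: card.empty) simp
    moreover have "\<alpha> * n \<ge> \<alpha> * n / 3" using n \<alpha> by simp
    ultimately show "\<exists>a\<in>A. \<exists>b\<in>B. {a, b} \<in> E"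
      using AB by (intro cross) (simp_all add: n_def)
  qed (use deg in \<open>auto simp: n_def\<close>)
  \<comment> \<open>The threshold is half the minimum degree: a vertex and its neighbours cannot fit
    into two classes below it, while each colour has at most \<open>2 / \<alpha>\<close> classes
    above it.\<close>
  define S1 where "S1 = {v \<in> V. real (card (conn ?E1 `` {v})) < \<alpha> * n / 2}"
  define S2 where "S2 = {v \<in> V. real (card (conn ?E2 `` {v})) < \<alpha> * n / 2}"
  have E12: "?E1 \<subseteq> all_pairs V" "?E2 \<subseteq> all_pairs V" using E by auto
  have d: "\<alpha> * n / 2 > 0" using n \<alpha> by simp
  have frac: "real (card V) / (\<alpha> * n / 2) = 2 / \<alpha>" using n \<alpha> by (simp add: n_def field_simps)
  obtain T1 where T1: "spanning_tree V E T1"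
    "(\<Sum>e\<in>T1. col e) \<ge> int (card V) + 1 - 2 * int (card (comps V ?E1))"
    by (rule spanning_tree_with_large_sum[OF V(1) E con col])
  obtain T2 where T2: "spanning_tree V E T2"
    "(\<Sum>e\<in>T2. - col e) \<ge> int (card V) + 1 - 2 * int (card (comps V ?E2))"
    by (rule spanning_tree_with_large_sum[OF V(1) E con, of "\<lambda>e. - col e"]) (use col in fastforce)+
  have "real_of_int (\<Sum>e\<in>T1. col e) < D" using contr T1(1) by force
  then have "n + 1 - 2 * real (card (comps V ?E1)) < D"
    using T1(2)[folded of_int_le_iff[where 'a = real]] by (simp add: n_def)
  moreover have "real (card (comps V ?E1)) \<le> 2 / \<alpha> + real (card S1)"
    using card_comps_le[OF V(1) E12(1) d] unfolding frac S1_def .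
  ultimately have s1: "real (card S1) > (n + 1 - D) / 2 - 2 / \<alpha>" by argo
  have "real_of_int (\<Sum>e\<in>T2. - col e) < D" using contr T2(1) by (force simp: sum_negf)
  then have "n + 1 - 2 * real (card (comps V ?E2)) < D"
    using T2(2)[folded of_int_le_iff[where 'a = real]] by (simp add: n_def)
  moreover have "real (card (comps V ?E2)) \<le> 2 / \<alpha> + real (card S2)"
    using card_comps_le[OF V(1) E12(2) d] unfolding frac S2_def .
  ultimately have s2: "real (card S2) > (n + 1 - D) / 2 - 2 / \<alpha>" by argo
  have disj: "S2 \<inter> S1 = {}"
  proof (rule ccontr)
    assume "S2 \<inter> S1 \<noteq> {}"
    then obtain v where v: "v \<in> V" "v \<in> S1" "v \<in> S2" by (auto simp: S1_def)
    have fin: "finite (conn ?E1 `` {v})" "finite (conn ?E2 `` {v})"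
      using conn_class_subset[OF E12(1) v(1)] conn_class_subset[OF E12(2) v(1)] V finite_subset by blast+
    have "nbrs E v = nbrs ?E1 v \<union> nbrs ?E2 v" using col by (fastforce simp: nbrs_def)
    also have "\<dots> \<subseteq> conn ?E1 `` {v} \<union> conn ?E2 `` {v}"
      using nbrs_subset_conn_class by (rule Un_mono) (rule nbrs_subset_conn_class)
    finally have "card (nbrs E v) \<le> card (conn ?E1 `` {v} \<union> conn ?E2 `` {v})"
      using fin by (intro card_mono) auto
    also have "\<dots> \<le> card (conn ?E1 `` {v}) + card (conn ?E2 `` {v})" by (rule card_Un_le)
    finally show False
      using deg[OF v(1)] v by (simp add: S1_def S2_def n_def)
  qed
  have sub: "S1 \<subseteq> V" "S2 \<subseteq> V" by (auto simp: S1_def S2_def)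
  have "V - S2 - S1 = V - (S2 \<union> S1)" by auto
  moreover have "card (V - (S2 \<union> S1)) = card V - card (S2 \<union> S1)"
    using sub V finite_subset by (intro card_Diff_subset) auto
  moreover have "card (S2 \<union> S1) = card S2 + card S1"
    using sub V finite_subset disj by (intro card_Un_disjoint) auto
  moreover have "card (S2 \<union> S1) \<le> card V" using sub V by (intro card_mono) auto
  ultimately have "real (card (V - S2 - S1)) = n - card S2 - card S1"
    by (simp add: n_def)
  \<comment> \<open>The two lower bounds add up to \<open>n + 1 - D - 4 / \<alpha>\<close>.\<close>
  also have "\<dots> \<le> D + 4 / \<alpha>" using s1 s2 by argo
  finally have w: "real (card (V - S2 - S1)) \<le> D + 4 / \<alpha>" .
  \<comment> \<open>The left side is \<open>(n + 1 - (D + 4 / \<alpha>)) / 2\<close>, and the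
    subtracted term is at most \<open>n / 3\<close>.\<close>
  have "(n + 1 - D) / 2 - 2 / \<alpha> \<ge> n / 3" using D(2) unfolding n_def[symmetric] by argo
  moreover have "\<alpha> * n / 3 \<le> n / 3" using \<alpha> n by simp
  ultimately have "\<alpha> * n / 3 \<le> card S1" "\<alpha> * n / 3 \<le> card S2" using s1 s2 by linarith+
  then obtain a b where ab: "a \<in> S2" "b \<in> S1" "{a, b} \<in> E"
    using cross[OF sub(2,1) disj] w by (auto simp: n_def)
  \<comment> \<open>Whatever its colour, the crossing edge puts its ends into one class of that
    colour, so one end would lie in both \<open>S1\<close> and \<open>S2\<close>.\<close>
  consider "{a, b} \<in> ?E1" | "{a, b} \<in> ?E2" using col[OF ab(3)] ab(3) by fastforce
  then show False
  proof cases
    case 1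
    then have "conn ?E1 `` {a} = conn ?E1 `` {b}" by (simp only: conn_class_eq_iff conn_edge)
    then have "a \<in> S1" using ab sub by (auto simp: S1_def)
    then show False using ab disj by auto
  next
    case 2
    then have "conn ?E2 `` {a} = conn ?E2 `` {b}" by (simp only: conn_class_eq_iff conn_edge)
    then have "b \<in> S2" using ab sub by (auto simp: S2_def)
    then show False using ab disj by auto
  qed
qed

subsection \<open>Reconstructing a separation from its trace\<close>

text \<open>Greedy choice: by averaging, some vertex \<open>x \<notin> S\<close> lies in the sets \<open>N v\<close>
  carrying an \<open>\<alpha>/2\<close> fraction of the total weight, and adding it to \<open>S\<close> halves their weights.\<close>

lemma exists_hitting_set:
  fixes \<alpha> :: real
  assumes V: "finite V" and \<alpha>: "0 < \<alpha>" "\<alpha> < 1"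
    and N: "\<And>v. v \<in> V \<Longrightarrow> N v \<subseteq> V" "\<And>v. v \<in> V \<Longrightarrow> \<alpha> * real (card V) \<le> real (card (N v))"
    and s: "real s \<le> \<alpha> * real (card V) / 2"
  shows "\<exists>S\<subseteq>V. card S = s \<and> (\<Sum>v\<in>V. (1 / 2) ^ card (N v \<inter> S)) \<le> (1 - \<alpha> / 4) ^ s * real (card V)"
  using s
proof (induction s)
  case 0
  show ?case by (rule exI[of _ "{}"]) simp
next
  case (Suc s)
  then obtain S where S: "S \<subseteq> V" "card S = s"
    and bound: "(\<Sum>v\<in>V. (1 / 2) ^ card (N v \<inter> S)) \<le> (1 - \<alpha> / 4) ^ s * real (card V)"
    by auto
  define n where "n = real (card V)"
  define \<phi> where "\<phi> v = ((1 / 2) ^ card (N v \<inter> S) :: real)" for v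
  define \<Phi> where "\<Phi> = (\<Sum>v\<in>V. \<phi> v)"
  define g where "g x = (\<Sum>v\<in>V. if x \<in> N v then \<phi> v else 0)" for x
  have finS: "finite S" using S V finite_subset by blast
  have \<phi>: "\<phi> v > 0" for v by (simp add: \<phi>_def)
  have sn: "real s < \<alpha> * n / 2" using Suc.prems by (simp add: n_def)
  have n: "n > 0" using sn \<alpha> by (smt (verit) divide_nonpos_pos mult_nonneg_nonpos of_nat_0_le_iff)
  have "\<alpha> * n < 1 * n" using \<alpha> n by (intro mult_strict_right_mono) auto
  then have "s < card V" using sn by (simp add: n_def)
  then have ne: "V - S \<noteq> {}" using S finS by (metis Diff_eq_empty_iff card_mono leD)
  have \<Phi>: "\<Phi> > 0" unfolding \<Phi>_def using V ne \<phi> by (intro sum_pos) auto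
  \<comment> \<open>Double counting the weighted incidences \<open>x \<in> N v\<close> with
    \<open>x\<close> outside \<open>S\<close>.\<close>
  have "\<exists>x\<in>V - S. g x \<ge> \<alpha> / 2 * \<Phi>"
  proof (rule ccontr)
    assume "\<not> ?thesis"
    then have "(\<Sum>x\<in>V - S. g x) < (\<Sum>x\<in>V - S. \<alpha> / 2 * \<Phi>)"
      using V ne by (intro sum_strict_mono) (auto simp: not_le)
    also have "\<dots> \<le> n * (\<alpha> / 2 * \<Phi>)"
      using \<Phi> \<alpha> V by (auto simp: n_def intro!: mult_right_mono card_mono)
    finally have "(\<Sum>x\<in>V - S. g x) < n * (\<alpha> / 2 * \<Phi>)" .
    moreover have "(\<Sum>x\<in>V - S. g x) = (\<Sum>v\<in>V. \<Sum>x\<in>V - S. if x \<in> N v then \<phi> v else 0)"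
      unfolding g_def by (rule sum.swap)
    moreover have "\<dots> = (\<Sum>v\<in>V. \<phi> v * real (card (N v - S)))"
    proof (rule sum.cong[OF refl])
      fix v assume "v \<in> V"
      then have "(V - S) \<inter> N v = N v - S" using N by auto
      then show "(\<Sum>x\<in>V - S. if x \<in> N v then \<phi> v else 0) = \<phi> v * real (card (N v - S))"
        using V by (simp flip: sum.inter_restrict)
    qed
    \<comment> \<open>\<open>S\<close> has fewer than \<open>\<alpha> * n / 2\<close> elements, so
      at least half of the guaranteed \<open>\<alpha> * n\<close> elements of \<open>N v\<close>
      remain available.\<close>
    moreover have "\<dots> \<ge> (\<Sum>v\<in>V. \<phi> v * (\<alpha> * n / 2))"
    proof (intro sum_mono mult_left_mono)
      fix v assume v: "v \<in> V"
      have "card (N v) - card S \<le> card (N v - S)" using finS by (rule diff_card_le_card_Diff)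
      then show "\<alpha> * n / 2 \<le> real (card (N v - S))"
        using N(2)[OF v] sn S(2) unfolding n_def by linarith
    qed (use \<phi> less_imp_le in auto)
    moreover have "(\<Sum>v\<in>V. \<phi> v * (\<alpha> * n / 2)) = n * (\<alpha> / 2 * \<Phi>)"
      by (simp add: \<Phi>_def sum_distrib_right[symmetric] sum_distrib_left[symmetric] sum_divide_distrib[symmetric])
    ultimately show False by linarith
  qed
  then obtain x where x: "x \<in> V - S" "g x \<ge> \<alpha> / 2 * \<Phi>" by blast
  have "(1 / 2) ^ card (N v \<inter> insert x S) = \<phi> v - (if x \<in> N v then \<phi> v else 0) / 2" for v
    using x finS by (auto simp: \<phi>_def Int_insert_right)
  then have "(\<Sum>v\<in>V. (1 / 2) ^ card (N v \<inter> insert x S)) = \<Phi> - g x / 2"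
    by (simp add: sum_subtractf \<Phi>_def g_def sum_divide_distrib)
  also have "\<dots> \<le> (1 - \<alpha> / 4) * \<Phi>" using x by argo
  also have "\<dots> \<le> (1 - \<alpha> / 4) * ((1 - \<alpha> / 4) ^ s * n)"
    using bound \<alpha> by (intro mult_left_mono) (auto simp: \<Phi>_def \<phi>_def n_def)
  finally show ?case
    using x S finS by (intro exI[of _ "insert x S"]) (auto simp: n_def mult_ac)
qed

text \<open>Every \<open>C\<close> greedy choices divide the total weight by at least 4, leaving at
  most \<open>n / 4^w\<close>. An exceptional vertex weighs at least \<open>1 / 2^w\<close>, so at
  most \<open>n / 2^w\<close> vertices are exceptional.\<close>

lemma exists_hitting_set_few_exceptions:
  fixes \<alpha> :: real
  assumes V: "finite V" and \<alpha>: "0 < \<alpha>" "\<alpha> < 1"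
    and N: "\<And>v. v \<in> V \<Longrightarrow> N v \<subseteq> V" "\<And>v. v \<in> V \<Longrightarrow> \<alpha> * real (card V) \<le> real (card (N v))"
    and C: "(1 - \<alpha> / 4) ^ C \<le> 1 / 4"
    and s: "real (C * w) \<le> \<alpha> * real (card V) / 2"
  obtains S where "S \<subseteq> V" "card S = C * w"
    "real (card {v \<in> V. card (N v \<inter> S) \<le> w}) \<le> (1 / 2) ^ w * real (card V)"
proof -
  obtain S where S: "S \<subseteq> V" "card S = C * w"
    and bound: "(\<Sum>v\<in>V. (1 / 2) ^ card (N v \<inter> S)) \<le> (1 - \<alpha> / 4) ^ (C * w) * real (card V)"
    using exists_hitting_set[of V \<alpha> N, OF V \<alpha> N s] by auto
  let ?B = "{v \<in> V. card (N v \<inter> S) \<le> w}"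
  have "real (card ?B) * (1 / 2) ^ w = (\<Sum>v\<in>?B. (1 / 2) ^ w)" by simp
  also have "\<dots> \<le> (\<Sum>v\<in>?B. (1 / 2) ^ card (N v \<inter> S))"
    by (intro sum_mono power_decreasing) auto
  also have "\<dots> \<le> (\<Sum>v\<in>V. (1 / 2) ^ card (N v \<inter> S))"
    using V by (intro sum_mono2) auto
  also have "\<dots> \<le> ((1 - \<alpha> / 4) ^ C) ^ w * real (card V)"
    using bound by (simp add: power_mult)
  also have "\<dots> \<le> (1 / 4) ^ w * real (card V)"
    using C \<alpha> by (intro mult_right_mono power_mono) auto
  also have "\<dots> = ((1 / 2) ^ w * real (card V)) * (1 / 2) ^ w"
    by (simp add: power_mult_distrib[symmetric])
  finally have "real (card ?B) \<le> (1 / 2) ^ w * real (card V)"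
    by (rule mult_right_le_imp_le) simp
  with S that show thesis by blast
qed

text \<open>Intended for \<open>X = A \<inter> S\<close> and \<open>Y = B \<inter> S\<close>: it
  guesses \<open>A\<close> from the trace. Exchanging \<open>X\<close> and \<open>Y\<close> guesses
  \<open>B\<close>, and the two guesses are always disjoint.\<close>

definition trace_side :: "'a set \<Rightarrow> 'a set set \<Rightarrow> 'a set \<Rightarrow> 'a set \<Rightarrow> 'a set" where
  "trace_side V G X Y = {v \<in> V. nbrs G v \<inter> X \<noteq> {} \<and> nbrs G v \<inter> Y = {}}"

definition cross_pairs :: "'a set \<Rightarrow> 'a set \<Rightarrow> 'a set set" where
  "cross_pairs A B = (\<lambda>(a, b). {a, b}) ` (A \<times> B)"

text \<open>Ordered pairs, so that the first projection reaches every edge meeting another. The set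
  is empty exactly when \<open>R\<close> has no two distinct intersecting edges.\<close>

definition adjacent_pairs :: "'a set set \<Rightarrow> ('a set \<times> 'a set) set" where
  "adjacent_pairs R = {(e, f). e \<in> R \<and> f \<in> R \<and> e \<noteq> f \<and> e \<inter> f \<noteq> {}}"

lemma finite_adjacent_pairs: "finite R \<Longrightarrow> finite (adjacent_pairs R)"
  by (rule finite_subset[of _ "R \<times> R"]) (auto simp: adjacent_pairs_def)

lemma card_cross_pairs:
  assumes "A \<inter> B = {}"
  shows "card (cross_pairs A B) = card A * card B"
proof -
  have "inj_on (\<lambda>(a, b). {a, b}) (A \<times> B)"
    using assms by (auto simp: inj_on_def doubleton_eq_iff)
  then show ?thesis
    by (simp add: cross_pairs_def card_image card_cartesian_product)
qed

lemma cross_pairs_subset: "A \<subseteq> V \<Longrightarrow> B \<subseteq> V \<Longrightarrow> A \<inter> B = {} \<Longrightarrow> cross_pairs A B \<subseteq> all_pairs V"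
  by (auto simp: cross_pairs_def all_pairs_def card_insert_if)

text \<open>Edges meeting no other edge of \<open>R\<close> are pairwise disjoint, so they inject into the cover.\<close>

lemma card_covered_edges_le:
  assumes "finite R" "finite W" "F \<subseteq> R" "\<And>e. e \<in> F \<Longrightarrow> e \<inter> W \<noteq> {}"
  shows "card F \<le> card W + card (adjacent_pairs R)"
proof -
  define F2 where "F2 = {e \<in> F. \<exists>f. (e, f) \<in> adjacent_pairs R}"
  define h where "h e = (SOME x. x \<in> e \<inter> W)" for e
  have h: "h e \<in> e \<inter> W" if "e \<in> F" for e
    unfolding h_def by (rule someI_ex) (use assms(4)[OF that] in auto)
  have fin: "finite F" using assms finite_subset by blast
  have "inj_on h (F - F2)"
  proof (rule inj_onI, rule ccontr)
    fix e f assume ef: "e \<in> F - F2" "f \<in> F - F2" "h e = h f" "e \<noteq> f"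
    then have "h e \<in> e \<inter> f" using h[of e] h[of f] by auto
    then have "(e, f) \<in> adjacent_pairs R" using ef assms(3) by (auto simp: adjacent_pairs_def)
    then show False using ef by (auto simp: F2_def)
  qed
  then have 1: "card (F - F2) \<le> card W"
    using assms(2) h by (intro card_inj_on_le[of h]) auto
  have "F2 \<subseteq> fst ` adjacent_pairs R" by (force simp: F2_def)
  then have "card F2 \<le> card (adjacent_pairs R)"
    using finite_adjacent_pairs[OF assms(1)] by (meson card_image_le card_mono finite_imageI order_trans)
  moreover have "card F = card F2 + card (F - F2)"
    using fin by (metis (no_types, lifting) F2_def card_Diff_subset card_mono finite_subset le_add_diff_inverse mem_Collect_eq subsetI)
  ultimately show ?thesis using 1 by linarith
qed

text \<open>If no edge crosses, each vertex of \<open>A\<close> having more than \<open>w\<close> neighbours in \<open>S\<close>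
  is recognised from \<open>A \<inter> S\<close> and \<open>B \<inter> S\<close> alone, so \<open>A\<close> and \<open>B\<close> are known up to few
  vertices and all random edges between the reconstructed sides meet the exceptional set.\<close>

lemma crossing_edge_exists:
  fixes \<delta> :: real
  assumes V: "finite V" and G: "G \<subseteq> all_pairs V" and R: "R \<subseteq> all_pairs V" and S: "S \<subseteq> V"
    and bad: "real (card {v \<in> V. card (nbrs G v \<inter> S) \<le> w}) \<le> \<epsilon>"
    and many: "\<And>X Y. \<lbrakk>X \<subseteq> S; Y \<subseteq> S; \<delta> - \<epsilon> \<le> real (card (trace_side V G X Y));
        \<delta> - \<epsilon> \<le> real (card (trace_side V G Y X))\<rbrakk> \<Longrightarrow>
      w + card (adjacent_pairs R) < card (R \<inter> cross_pairs (trace_side V G X Y) (trace_side V G Y X))"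
    and AB: "A \<subseteq> V" "B \<subseteq> V" "A \<inter> B = {}" "\<delta> \<le> real (card A)" "\<delta> \<le> real (card B)"
    and w: "card (V - A - B) \<le> w"
  shows "\<exists>a\<in>A. \<exists>b\<in>B. {a, b} \<in> G \<union> R"
proof (rule ccontr)
  assume contr: "\<not> ?thesis"
  let ?bad = "{v \<in> V. card (nbrs G v \<inter> S) \<le> w}"
  let ?T = "trace_side V G"
  \<comment> \<open>Stated for arbitrary sides, to be used for \<open>(A, B)\<close> and for
    \<open>(B, A)\<close>.\<close>
  have side: "A - ?bad \<subseteq> ?T (A \<inter> S) (B \<inter> S)" "\<delta> - \<epsilon> \<le> real (card (?T (A \<inter> S) (B \<inter> S)))"
    if AB: "A \<subseteq> V" "B \<subseteq> V" "\<delta> \<le> real (card A)" and w: "card (V - A - B) \<le> w"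
      and no: "\<And>a b. a \<in> A \<Longrightarrow> b \<in> B \<Longrightarrow> {a, b} \<notin> G" for A B
  proof -
    show sub: "A - ?bad \<subseteq> ?T (A \<inter> S) (B \<inter> S)"
    proof
      fix v assume v: "v \<in> A - ?bad"
      then have vV: "v \<in> V" using AB by auto
      have nB: "nbrs G v \<inter> B = {}" using no v by (auto simp: nbrs_def)
      \<comment> \<open>Otherwise the more than \<open>w\<close> neighbours of \<open>v\<close> in
        \<open>S\<close> would all lie among the at most \<open>w\<close> vertices outside
        \<open>A\<close> and \<open>B\<close>.\<close>
      have "nbrs G v \<inter> (A \<inter> S) \<noteq> {}"
      proof
        assume "nbrs G v \<inter> (A \<inter> S) = {}"
        then have "nbrs G v \<inter> S \<subseteq> V - A - B" using nB nbrs_subset[OF G] by blast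
        then have "card (nbrs G v \<inter> S) \<le> card (V - A - B)" using V by (intro card_mono) auto
        then show False using v w vV by auto
      qed
      with nB vV show "v \<in> ?T (A \<inter> S) (B \<inter> S)" by (auto simp: trace_side_def)
    qed
    have "card A - card ?bad \<le> card (A - ?bad)" using V by (intro diff_card_le_card_Diff) auto
    also have "\<dots> \<le> card (?T (A \<inter> S) (B \<inter> S))"
      using V sub by (intro card_mono) (auto simp: trace_side_def)
    finally show "\<delta> - \<epsilon> \<le> real (card (?T (A \<inter> S) (B \<inter> S)))"
      using AB bad by linarith
  qed
  let ?A = "?T (A \<inter> S) (B \<inter> S)" and ?B = "?T (B \<inter> S) (A \<inter> S)"
  have no: "{a, b} \<notin> G" "{b, a} \<notin> G" if "a \<in> A" "b \<in> B" for a b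
    using contr that by (auto simp: insert_commute)
  have VBA: "V - B - A = V - A - B" by auto
  have "w + card (adjacent_pairs R) < card (R \<inter> cross_pairs ?A ?B)"
  proof (rule many)
    show "\<delta> - \<epsilon> \<le> real (card ?A)" using AB w no by (intro side) auto
    show "\<delta> - \<epsilon> \<le> real (card ?B)" using AB w no by (intro side) (auto simp: VBA)
  qed auto
  moreover have "card (R \<inter> cross_pairs ?A ?B) \<le> card (V - A - B) + card (adjacent_pairs R)"
  proof (rule card_covered_edges_le)
    show "finite R" using R V finite_all_pairs finite_subset by blast
    fix e assume "e \<in> R \<inter> cross_pairs ?A ?B"
    then obtain a b where e: "e \<in> R" "e = {a, b}" "a \<in> ?A" "b \<in> ?B" by (auto simp: cross_pairs_def)
    \<comment> \<open>A vertex of \<open>?A\<close> has a neighbour in \<open>A\<close>, so if it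
      lay in \<open>B\<close> an edge of \<open>G\<close> would cross.\<close>
    have "a \<in> V - B"
      using e(3) no by (auto simp: trace_side_def nbrs_def)
    moreover have "b \<in> V - A"
      using e(4) no by (auto simp: trace_side_def nbrs_def)
    moreover have "\<not> (a \<in> A \<and> b \<in> B)" using contr e by auto
    ultimately show "e \<inter> (V - A - B) \<noteq> {}" using e(2) by auto
  qed (use V in auto)
  ultimately show False using w by linarith
qed

subsection \<open>Binomial random graphs\<close>

lemma set_pmf_gnp: "set_pmf (gnp n p) \<subseteq> Pow (all_pairs {1..n})"
  by (auto simp: gnp_def)

lemma integrable_gnp: "integrable (measure_pmf (gnp n p)) (f :: _ \<Rightarrow> real)"
  by (rule integrable_measure_pmf_finite)
    (use finite_subset[OF set_pmf_gnp] finite_all_pairs in blast)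

text \<open>The power is a product of one factor per pair, and independence turns its mean into the
  product of the single means.\<close>

lemma expectation_gnp_power:
  fixes p c :: real
  assumes p: "0 \<le> p" "p \<le> 1" and c: "0 \<le> c" and P: "P \<subseteq> all_pairs {1..n}"
  shows "measure_pmf.expectation (gnp n p) (\<lambda>R. c ^ card (R \<inter> P)) = (1 - p + p * c) ^ card P"
proof -
  let ?A = "all_pairs {1..n}"
  define f where "f e b = (if e \<in> P \<and> b then c else 1)" for e and b :: bool
  have A: "finite ?A" by (simp add: finite_all_pairs)
  have "c ^ card ({e \<in> ?A. X e} \<inter> P) = (\<Prod>e\<in>?A. f e (X e))" for X
  proof -
    have "(\<Prod>e\<in>?A. f e (X e)) = (\<Prod>e\<in>?A \<inter> {e. e \<in> P \<and> X e}. c)"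
      using A by (simp add: f_def prod.If_cases)
    also have "?A \<inter> {e. e \<in> P \<and> X e} = {e \<in> ?A. X e} \<inter> P" by auto
    finally show ?thesis by simp
  qed
  then have "measure_pmf.expectation (gnp n p) (\<lambda>R. c ^ card (R \<inter> P)) =
      measure_pmf.expectation (Pi_pmf ?A False (\<lambda>_. bernoulli_pmf p)) (\<lambda>X. \<Prod>e\<in>?A. f e (X e))"
    by (simp add: gnp_def)
  also have "\<dots> = (\<Prod>e\<in>?A. measure_pmf.expectation (bernoulli_pmf p) (f e))"
    using A c by (intro expectation_prod_Pi_pmf) (auto simp: f_def intro: integrable_measure_pmf_finite)
  also have "\<dots> = (\<Prod>e\<in>?A. if e \<in> P then 1 - p + p * c else 1)"
    using p by (intro prod.cong refl) (auto simp: f_def algebra_simps)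
  also have "\<dots> = (\<Prod>e\<in>?A \<inter> P. 1 - p + p * c)"
    using A by (simp add: prod.If_cases)
  also have "?A \<inter> P = P" using P by auto
  finally show ?thesis by simp
qed

text \<open>A Chernoff bound for the lower tail: Markov's inequality for
  \<open>(1 / 2) ^ card (R \<inter> P)\<close>, with 2 estimated by e in the threshold.\<close>

lemma prob_gnp_few_edges:
  fixes p t :: real
  assumes p: "0 \<le> p" "p \<le> 1" and P: "P \<subseteq> all_pairs {1..n}"
  shows "measure_pmf.prob (gnp n p) {R. real (card (R \<inter> P)) \<le> t} \<le> exp (t - p * real (card P) / 2)"
proof -
  have "indicator {R. real (card (R \<inter> P)) \<le> t} R \<le> exp t * (1 / 2) ^ card (R \<inter> P)" for R
  proof (cases "real (card (R \<inter> P)) \<le> t")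
    case True
    have "(2::real) ^ card (R \<inter> P) \<le> exp 1 ^ card (R \<inter> P)"
      using exp_ge_add_one_self[of 1] by (intro power_mono) auto
    also have "\<dots> = exp (real (card (R \<inter> P)))" by (simp add: exp_of_nat_mult[symmetric])
    also have "\<dots> \<le> exp t" using True by simp
    finally show ?thesis using True by (simp add: field_simps)
  qed simp
  then have "measure_pmf.expectation (gnp n p) (indicator {R. real (card (R \<inter> P)) \<le> t}) \<le>
      measure_pmf.expectation (gnp n p) (\<lambda>R. exp t * (1 / 2) ^ card (R \<inter> P))"
    by (intro integral_mono integrable_gnp) auto
  also have "\<dots> = exp t * (1 - p / 2) ^ card P"
    using expectation_gnp_power[OF p _ P, of "1 / 2"] by simp
  also have "\<dots> \<le> exp t * exp (- p / 2) ^ card P"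
    using p exp_ge_add_one_self[of "- p / 2"] by (intro mult_left_mono power_mono) auto
  also have "\<dots> = exp (t - p * real (card P) / 2)"
    by (simp add: exp_of_nat_mult[symmetric] exp_add[symmetric] field_simps)
  finally show ?thesis by simp
qed

section \<open>Adjacent pairs of random edges\<close>

lemma prob_gnp_two_edges:
  fixes p :: real
  assumes p: "0 \<le> p" "p \<le> 1" and ef: "e \<in> all_pairs {1..n}" "f \<in> all_pairs {1..n}" "e \<noteq> f"
  shows "measure_pmf.prob (gnp n p) {R. e \<in> R \<and> f \<in> R} = p\<^sup>2"
proof -
  let ?A = "all_pairs {1..n}"
  have A: "finite ?A" by (simp add: finite_all_pairs)
  define B where "B x = (if x \<in> {e, f} then {True} else UNIV)" for x
  \<comment> \<open>The event fixes two coordinates and leaves the rest free, so it is a product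
    set.\<close>
  have "(\<lambda>X. {e \<in> ?A. X e}) -` {R. e \<in> R \<and> f \<in> R} = Pi ?A B"
    using ef by (auto simp: B_def Pi_def)
  then have "measure_pmf.prob (gnp n p) {R. e \<in> R \<and> f \<in> R} =
      measure_pmf.prob (Pi_pmf ?A False (\<lambda>_. bernoulli_pmf p)) (Pi ?A B)"
    by (simp add: gnp_def)
  also have "\<dots> = (\<Prod>x\<in>?A. measure_pmf.prob (bernoulli_pmf p) (B x))"
    by (rule measure_Pi_pmf_Pi[OF A])
  also have "\<dots> = (\<Prod>x\<in>?A. if x \<in> {e, f} then p else 1)"
    using p by (intro prod.cong refl) (auto simp: B_def measure_pmf_single)
  also have "\<dots> = (\<Prod>x\<in>?A \<inter> {e, f}. p)"
    using A by (simp only: prod.inter_restrict)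
  also have "?A \<inter> {e, f} = {e, f}" using ef by auto
  finally show ?thesis using ef by (simp add: power2_eq_square)
qed

text \<open>Such a pair is determined by a common vertex and the two other ends.\<close>

lemma card_adjacent_pairs_all_pairs_le: "card (adjacent_pairs (all_pairs {1..n::nat})) \<le> n ^ 3"
proof -
  let ?V = "{1..n}"
  have "adjacent_pairs (all_pairs ?V) \<subseteq> (\<lambda>(x, y, z). ({x, y}, {x, z})) ` (?V \<times> ?V \<times> ?V)"
  proof
    fix q assume "q \<in> adjacent_pairs (all_pairs ?V)"
    then obtain e f where q: "q = (e, f)" and ef: "e \<in> all_pairs ?V" "f \<in> all_pairs ?V" "e \<inter> f \<noteq> {}"
      by (auto simp: adjacent_pairs_def)
    obtain x where x: "x \<in> e" "x \<in> f" using ef by auto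
    have other: "\<exists>y\<in>?V. g = {x, y}" if g: "g \<in> all_pairs ?V" "x \<in> g" for g
    proof -
      obtain u v where uv: "g = {u, v}" "u \<in> ?V" "v \<in> ?V" using g(1) by (rule all_pairsE)
      then have "g = {x, v} \<or> g = {x, u}" using g(2) by (auto simp: insert_commute)
      then show ?thesis using uv(2,3) by blast
    qed
    obtain y z where "y \<in> ?V" "z \<in> ?V" "e = {x, y}" "f = {x, z}"
      using other[OF ef(1) x(1)] other[OF ef(2) x(2)] by blast
    moreover have "x \<in> ?V" using x ef by (auto simp: all_pairs_def)
    ultimately show "q \<in> (\<lambda>(x, y, z). ({x, y}, {x, z})) ` (?V \<times> ?V \<times> ?V)"
      unfolding q by (intro image_eqI[of _ _ "(x, y, z)"]) simp_all
  qed
  then have "card (adjacent_pairs (all_pairs ?V)) \<le> card (?V \<times> ?V \<times> ?V)"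
    by (intro surj_card_le) auto
  then show ?thesis by (simp add: card_cartesian_product power3_eq_cube)
qed

text \<open>First moment and Markov: at most \<open>n ^ 3\<close> candidate pairs, each present with
  probability \<open>p\<^sup>2\<close>.\<close>

lemma prob_gnp_many_adjacent_pairs:
  fixes p t :: real
  assumes p: "0 \<le> p" "p \<le> 1" and t: "t > 0"
  shows "measure_pmf.prob (gnp n p) {R. t \<le> real (card (adjacent_pairs R))} \<le> real n ^ 3 * p\<^sup>2 / t"
proof -
  let ?Q = "adjacent_pairs (all_pairs {1..n})"
  have finQ: "finite ?Q" by (simp add: finite_adjacent_pairs finite_all_pairs)
  have "measure_pmf.expectation (gnp n p) (\<lambda>R. real (card (adjacent_pairs R))) =
      measure_pmf.expectation (gnp n p) (\<lambda>R. \<Sum>q\<in>?Q. indicator {R. fst q \<in> R \<and> snd q \<in> R} R)"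
  proof (rule integral_cong_AE)
    show "AE R in gnp n p. real (card (adjacent_pairs R)) =
        (\<Sum>q\<in>?Q. indicator {R. fst q \<in> R \<and> snd q \<in> R} R)"
    proof (rule AE_pmfI)
      fix R assume "R \<in> set_pmf (gnp n p)"
      then have "R \<subseteq> all_pairs {1..n}" using set_pmf_gnp by blast
      then have "adjacent_pairs R = {q \<in> ?Q. fst q \<in> R \<and> snd q \<in> R}"
        by (auto simp: adjacent_pairs_def)
      then show "real (card (adjacent_pairs R)) = (\<Sum>q\<in>?Q. indicator {R. fst q \<in> R \<and> snd q \<in> R} R)"
        using finQ by (simp add: indicator_def sum.If_cases Int_def)
    qed
  qed auto
  also have "\<dots> = (\<Sum>q\<in>?Q. measure_pmf.prob (gnp n p) {R. fst q \<in> R \<and> snd q \<in> R})"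
    by (subst Bochner_Integration.integral_sum) (auto intro: integrable_gnp)
  also have "\<dots> = (\<Sum>q\<in>?Q. p\<^sup>2)"
    by (intro sum.cong refl prob_gnp_two_edges p) (auto simp: adjacent_pairs_def)
  also have "\<dots> \<le> real n ^ 3 * p\<^sup>2"
    using card_adjacent_pairs_all_pairs_le[of n, folded of_nat_le_iff[where 'a = real]]
    by (simp add: mult_right_mono)
  finally have E: "measure_pmf.expectation (gnp n p) (\<lambda>R. real (card (adjacent_pairs R))) \<le> real n ^ 3 * p\<^sup>2" .
  have "measure_pmf.prob (gnp n p) {R \<in> space (measure_pmf (gnp n p)). t \<le> real (card (adjacent_pairs R))} \<le>
      measure_pmf.expectation (gnp n p) (\<lambda>R. real (card (adjacent_pairs R))) / t"
    using t by (intro integral_Markov_inequality_measure[where A = "{}"] integrable_gnp) auto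
  also have "\<dots> \<le> real n ^ 3 * p\<^sup>2 / t" using E t by (intro divide_right_mono) auto
  finally show ?thesis by simp
qed

subsection \<open>Random perturbation\<close>

text \<open>A union bound over the \<open>4 ^ (C * w)\<close> possible traces, plus the event of too
  many adjacent pairs. Outside these events the deterministic lemmas handle all colourings at
  once.\<close>

lemma prob_discrepancy_ge:
  fixes \<alpha> p D :: real and n w C :: nat and G :: "nat set set"
  defines "\<kappa> \<equiv> \<alpha>\<^sup>2 / 64" and "x \<equiv> p * (real n)\<^sup>2"
  assumes \<alpha>: "0 < \<alpha>" "\<alpha> < 1" and p: "0 \<le> p" "p \<le> 1"
    and G: "simple_graph {1..n} G" "\<alpha> * real n \<le> real (min_degree {1..n} G)"
    and C: "(1 - \<alpha> / 4) ^ C \<le> 1 / 4" "real (C * w) \<le> \<alpha> * real n / 2"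
    and w: "(1 / 2) ^ w \<le> \<alpha> / 12" "D + 4 / \<alpha> \<le> real w" "real w \<le> \<kappa> * x / 2"
    and D: "0 \<le> D" "D + 4 / \<alpha> \<le> real n / 3"
  shows "measure_pmf.prob (gnp n p)
         {R. \<forall>col :: nat set \<Rightarrow> int. (\<forall>e \<in> G \<union> R. col e \<in> {1, -1}) \<longrightarrow>
             (\<exists>T. spanning_tree {1..n} (G \<union> R) T \<and> \<bar>real_of_int (\<Sum>e\<in>T. col e)\<bar> \<ge> D)}
     \<ge> 1 - (4 ^ (C * w) * exp (- \<kappa> * x) + 2 * (p * real n) / \<kappa>)" (is "measure_pmf.prob _ ?Good \<ge> _")
proof -
  let ?V = "{1..n}"
  have \<kappa>: "\<kappa> > 0" using \<alpha> by (simp add: \<kappa>_def)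
  have "4 / \<alpha> > 0" using \<alpha> by simp
  then have "\<kappa> * x > 0" using D(1) w(2,3) by linarith
  moreover have "real n > 0" using D \<open>4 / \<alpha> > 0\<close> by linarith
  then have "n > 0" by simp
  ultimately have p0: "p > 0" using \<kappa> p by (auto simp: zero_less_mult_iff x_def)
  have GV: "G \<subseteq> all_pairs ?V" using G by (simp add: simple_graph_def)
  have deg: "\<alpha> * real (card ?V) \<le> real (card (nbrs G v))" if "v \<in> ?V" for v
  proof -
    have "min_degree ?V G \<le> vertex_degree G v"
      using that by (auto simp: min_degree_def intro: Min_le)
    then show ?thesis using G vertex_degree_eq_card_nbrs[OF GV, of v] by simp
  qed
  \<comment> \<open>\<open>S\<close> depends on \<open>G\<close> alone, so the events indexed by its
    traces are fixed before the random edges are exposed.\<close>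
  obtain S where S: "S \<subseteq> ?V" "card S = C * w"
    and bad: "real (card {v \<in> ?V. card (nbrs G v \<inter> S) \<le> w}) \<le> (1 / 2) ^ w * real (card ?V)"
    using exists_hitting_set_few_exceptions[of ?V \<alpha> "nbrs G" C w] \<alpha> nbrs_subset[OF GV] deg C by auto
  have "(1 / 2) ^ w * real (card ?V) \<le> \<alpha> / 12 * real (card ?V)"
    using w(1) by (intro mult_right_mono) auto
  with bad have bad: "real (card {v \<in> ?V. card (nbrs G v \<inter> S) \<le> w}) \<le> \<alpha> * real n / 12" by simp
  let ?T = "trace_side ?V G"
  \<comment> \<open>A side has at least \<open>\<alpha> * n / 3\<close> vertices and loses at most
    \<open>\<alpha> * n / 12\<close> exceptional ones, which leaves
    \<open>\<alpha> * n / 4\<close>.\<close>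
  define I where "I = {(X, Y) \<in> Pow S \<times> Pow S.
    \<alpha> * real n / 4 \<le> real (card (?T X Y)) \<and> \<alpha> * real n / 4 \<le> real (card (?T Y X))}"
  define P where "P q = cross_pairs (?T (fst q) (snd q)) (?T (snd q) (fst q))" for q
  define Few where "Few q = {R :: nat set set. real (card (R \<inter> P q)) \<le> \<kappa> * x}" for q
  define Adj where "Adj = {R :: nat set set. \<kappa> * x / 2 \<le> real (card (adjacent_pairs R))}"
  have finS: "finite S" using S finite_subset by blast
  have "I \<subseteq> Pow S \<times> Pow S" by (auto simp: I_def)
  then have finI: "finite I" using finS by (meson finite_Pow_iff finite_SigmaI finite_subset)
  have "card I \<le> card (Pow S \<times> Pow S)"
    using finS \<open>I \<subseteq> Pow S \<times> Pow S\<close> by (intro card_mono) simp_all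
  also have "\<dots> = 4 ^ (C * w)"
    using finS S by (simp add: card_cartesian_product card_Pow power_mult_distrib[symmetric])
  finally have cardI: "real (card I) \<le> 4 ^ (C * w)"
    by (metis of_nat_le_iff of_nat_numeral of_nat_power)
  have few: "measure_pmf.prob (gnp n p) (Few q) \<le> exp (- \<kappa> * x)" if "q \<in> I" for q
  proof -
    obtain X Y where q: "q = (X, Y)" by (cases q)
    have disj: "?T X Y \<inter> ?T Y X = {}" by (auto simp: trace_side_def)
    have "P q \<subseteq> all_pairs ?V"
      unfolding P_def q by (rule cross_pairs_subset) (use disj in \<open>auto simp: trace_side_def\<close>)
    then have "measure_pmf.prob (gnp n p) (Few q) \<le> exp (\<kappa> * x - p * real (card (P q)) / 2)"
      unfolding Few_def by (rule prob_gnp_few_edges[OF p])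
    also have "\<dots> \<le> exp (- \<kappa> * x)"
    proof -
      have "(\<alpha> * real n / 4) * (\<alpha> * real n / 4) \<le> real (card (?T X Y)) * real (card (?T Y X))"
        using that q \<alpha> by (intro mult_mono) (auto simp: I_def)
      also have "\<dots> = real (card (P q))" using disj by (simp add: P_def q card_cross_pairs)
      finally have "p * ((\<alpha> * real n / 4) * (\<alpha> * real n / 4)) \<le> p * real (card (P q))"
        using p by (intro mult_left_mono)
      \<comment> \<open>The expected number of crossing random edges is thus at least
        \<open>4 * \<kappa> * x\<close>; this fixes \<open>\<kappa>\<close> and makes the Chernoff
        exponent at most \<open>\<kappa> * x - 2 * \<kappa> * x\<close>.\<close>
      moreover have "p * ((\<alpha> * real n / 4) * (\<alpha> * real n / 4)) = 4 * (\<kappa> * x)"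
        by (simp add: \<kappa>_def x_def power2_eq_square)
      ultimately show ?thesis by simp
    qed
    finally show ?thesis .
  qed
  have "measure_pmf.prob (gnp n p) Adj \<le> real n ^ 3 * p\<^sup>2 / (\<kappa> * x / 2)"
    unfolding Adj_def using \<open>\<kappa> * x > 0\<close> by (intro prob_gnp_many_adjacent_pairs p) simp
  also have "\<dots> = 2 * (p * real n) / \<kappa>"
    using \<kappa> p0 \<open>n > 0\<close> by (simp add: x_def field_simps power2_eq_square power3_eq_cube)
  finally have adj: "measure_pmf.prob (gnp n p) Adj \<le> 2 * (p * real n) / \<kappa>" .
  have good: "R \<in> ?Good" if R: "R \<in> set_pmf (gnp n p)"
    and nf: "\<And>q. q \<in> I \<Longrightarrow> R \<notin> Few q" and na: "R \<notin> Adj" for R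
  proof -
    have RV: "R \<subseteq> all_pairs ?V" using R set_pmf_gnp by blast
    then have HV: "G \<union> R \<subseteq> all_pairs ?V" using GV by auto
    show ?thesis
    proof (intro CollectI allI impI)
      fix col :: "nat set \<Rightarrow> int" assume col: "\<forall>e \<in> G \<union> R. col e \<in> {1, -1}"
      show "\<exists>T. spanning_tree ?V (G \<union> R) T \<and> \<bar>real_of_int (\<Sum>e\<in>T. col e)\<bar> \<ge> D"
      proof (rule discrepancy_of_crossing[OF _ _ HV \<alpha>])
        fix v assume v: "v \<in> ?V"
        have "card (nbrs G v) \<le> card (nbrs (G \<union> R) v)"
          by (rule card_mono[OF finite_subset[OF nbrs_subset[OF HV]]]) (auto simp: nbrs_def)
        then show "\<alpha> * real (card ?V) \<le> real (card (nbrs (G \<union> R) v))" using deg[OF v] by linarith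
      next
        fix A B assume AB: "A \<subseteq> ?V" "B \<subseteq> ?V" "A \<inter> B = {}" "\<alpha> * real (card ?V) / 3 \<le> real (card A)"
          "\<alpha> * real (card ?V) / 3 \<le> real (card B)" and W: "real (card (?V - A - B)) \<le> D + 4 / \<alpha>"
        have W': "card (?V - A - B) \<le> w" using W w(2) by linarith
        show "\<exists>a\<in>A. \<exists>b\<in>B. {a, b} \<in> G \<union> R"
        proof (rule crossing_edge_exists[OF _ GV RV S(1) bad _ AB W'])
          fix X Y assume XY: "X \<subseteq> S" "Y \<subseteq> S"
            "\<alpha> * real (card ?V) / 3 - \<alpha> * real n / 12 \<le> real (card (?T X Y))"
            "\<alpha> * real (card ?V) / 3 - \<alpha> * real n / 12 \<le> real (card (?T Y X))"
          then have "(X, Y) \<in> I" by (simp add: I_def field_simps)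
          then have "\<kappa> * x < real (card (R \<inter> cross_pairs (?T X Y) (?T Y X)))"
            using nf[of "(X, Y)"] by (simp add: Few_def P_def)
          \<comment> \<open>Half of \<open>\<kappa> * x\<close> is allotted to \<open>w\<close>, the
            other half to adjacent pairs.\<close>
          moreover have "real (card (adjacent_pairs R)) < \<kappa> * x / 2" using na by (simp add: Adj_def)
          ultimately have "real (w + card (adjacent_pairs R)) < real (card (R \<inter> cross_pairs (?T X Y) (?T Y X)))"
            using w(3) by simp
          then show "w + card (adjacent_pairs R) < card (R \<inter> cross_pairs (?T X Y) (?T Y X))"
            by (simp only: of_nat_less_iff)
        qed simp
      qed (use col D \<open>n > 0\<close> in auto)
    qed
  qed
  have "1 - measure_pmf.prob (gnp n p) ?Good = measure_pmf.prob (gnp n p) (- ?Good)"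
    by (subst measure_pmf.prob_compl[symmetric]) (auto simp: Compl_eq_Diff_UNIV)
  \<comment> \<open>The inclusion of events holds only on the support, where \<open>R\<close>
    consists of pairs from \<open>?V\<close>.\<close>
  also have "\<dots> \<le> measure_pmf.prob (gnp n p) ((\<Union>q\<in>I. Few q) \<union> Adj)"
    by (rule measure_pmf.finite_measure_mono_AE)
      (use good in \<open>auto simp only: AE_measure_pmf_iff Compl_iff UN_iff Un_iff sets_measure_pmf UNIV_I\<close>)
  also have "\<dots> \<le> measure_pmf.prob (gnp n p) (\<Union>q\<in>I. Few q) + measure_pmf.prob (gnp n p) Adj"
    by (rule measure_Un_le) auto
  finally have fail: "1 - measure_pmf.prob (gnp n p) ?Good \<le>
      measure_pmf.prob (gnp n p) (\<Union>q\<in>I. Few q) + measure_pmf.prob (gnp n p) Adj" .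
  have "measure_pmf.prob (gnp n p) (\<Union>q\<in>I. Few q) \<le> (\<Sum>q\<in>I. measure_pmf.prob (gnp n p) (Few q))"
    using finI by (intro measure_UNION_le) auto
  also have "\<dots> \<le> (\<Sum>q\<in>I. exp (- \<kappa> * x))"
    by (rule sum_mono) (rule few)
  also have "\<dots> \<le> 4 ^ (C * w) * exp (- \<kappa> * x)"
    using cardI by simp
  finally show ?thesis using adj fail by linarith
qed

section \<open>Choice of the constants and passage to the limit\<close>

theorem theorem1p4:
  fixes \<alpha> :: real
  assumes "0 < \<alpha>" and "\<alpha> < 1"
  shows "\<exists>lam::real. lam > 0 \<and>
    (\<forall>(G :: nat \<Rightarrow> nat set set) (p :: nat \<Rightarrow> real).
      (\<forall>\<^sub>F n in sequentially. simple_graph {1..n} (G n) \<and>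
          real (min_degree {1..n} (G n)) \<ge> \<alpha> * real n) \<longrightarrow>
      (\<forall>n. 0 \<le> p n \<and> p n \<le> 1) \<longrightarrow>
      filterlim (\<lambda>n. p n * (real n)\<^sup>2) at_top sequentially \<longrightarrow>
      (\<lambda>n. p n * real n) \<longlonglongrightarrow> 0 \<longrightarrow>
      (\<lambda>n. measure_pmf.prob (gnp n (p n))
         {R. \<forall>col :: nat set \<Rightarrow> int. (\<forall>e \<in> G n \<union> R. col e \<in> {1, -1}) \<longrightarrow>
             (\<exists>T. spanning_tree {1..n} (G n \<union> R) T \<and>
                  \<bar>real_of_int (\<Sum>e\<in>T. col e)\<bar> \<ge> lam * p n * (real n)\<^sup>2)})
        \<longlonglongrightarrow> 1)"
proof -
  define \<kappa> where "\<kappa> = \<alpha>\<^sup>2 / 64"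
  have "\<alpha>\<^sup>2 \<le> \<alpha>" using assms by (simp add: power2_eq_square mult_left_le)
  then have \<kappa>: "0 < \<kappa>" "\<kappa> \<le> \<alpha> / 64" using assms by (auto simp: \<kappa>_def)
  obtain C where C: "(1 - \<alpha> / 4) ^ C < 1 / 4"
    using real_arch_pow_inv[of "1 / 4" "1 - \<alpha> / 4"] assms by auto
  have C1: "C \<ge> 1" using C by (cases C) auto
  obtain k where k: "(1 / 2) ^ k < \<alpha> / 12"
    using real_arch_pow_inv[of "\<alpha> / 12" "1 / 2"] assms by auto
  \<comment> \<open>Since \<open>w\<close> will be at most \<open>2 * lam * x\<close>, this gives
    \<open>C * w \<le> \<kappa> * x / 4\<close>, so the number of traces costs only half of the
    exponent \<open>\<kappa> * x\<close>.\<close>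
  define lam where "lam = \<kappa> / (8 * C)"
  have lam: "lam > 0" "8 * C * lam = \<kappa>" using \<kappa> C1 by (auto simp: lam_def)
  have "8 * lam * 1 \<le> 8 * lam * real C" using lam C1 by (intro mult_left_mono) auto
  then have "lam * 8 \<le> \<kappa>" using lam(2) by (simp add: mult_ac)
  show ?thesis
  proof (intro exI[of _ lam] conjI allI impI)
    fix G :: "nat \<Rightarrow> nat set set" and p :: "nat \<Rightarrow> real"
    assume G: "\<forall>\<^sub>F n in sequentially. simple_graph {1..n} (G n) \<and> real (min_degree {1..n} (G n)) \<ge> \<alpha> * real n"
      and p: "\<forall>n. 0 \<le> p n \<and> p n \<le> 1"
      and large: "filterlim (\<lambda>n. p n * (real n)\<^sup>2) at_top sequentially"
      and small: "(\<lambda>n. p n * real n) \<longlonglongrightarrow> 0"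
    let ?pr = "\<lambda>n. measure_pmf.prob (gnp n (p n))
         {R. \<forall>col :: nat set \<Rightarrow> int. (\<forall>e \<in> G n \<union> R. col e \<in> {1, -1}) \<longrightarrow>
             (\<exists>T. spanning_tree {1..n} (G n \<union> R) T \<and>
                  \<bar>real_of_int (\<Sum>e\<in>T. col e)\<bar> \<ge> lam * p n * (real n)\<^sup>2)}"
    let ?b = "\<lambda>n. 1 - (exp (- (\<kappa> / 2 * (p n * (real n)\<^sup>2))) + 2 * (p n * real n) / \<kappa>)"
    have "filterlim (\<lambda>n. \<kappa> / 2 * (p n * (real n)\<^sup>2)) at_top sequentially"
      using \<kappa> large by (intro filterlim_tendsto_pos_mult_at_top[OF tendsto_const]) auto
    then have "(\<lambda>n. exp (- (\<kappa> / 2 * (p n * (real n)\<^sup>2)))) \<longlonglongrightarrow> 0"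
      by (intro filterlim_compose[OF exp_at_bot]) (simp add: filterlim_uminus_at_bot)
    moreover have "(\<lambda>n. 2 * (p n * real n) / \<kappa>) \<longlonglongrightarrow> 2 * 0 / \<kappa>"
      using \<kappa> by (intro tendsto_intros small) auto
    ultimately have "?b \<longlonglongrightarrow> 1 - (0 + 2 * 0 / \<kappa>)" by (intro tendsto_diff tendsto_add tendsto_const)
    then have lim: "?b \<longlonglongrightarrow> 1" by simp
    \<comment> \<open>Ensures \<open>4 / \<alpha> + 1 \<le> lam * x\<close>, which absorbs the
      additive terms in \<open>w\<close>, and also \<open>w \<ge> k\<close>.\<close>
    have e1: "\<forall>\<^sub>F n in sequentially. p n * (real n)\<^sup>2 \<ge> (4 / \<alpha> + 1 + k) / lam"
      using large by (simp add: filterlim_at_top)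
    have e2: "\<forall>\<^sub>F n in sequentially. p n * real n < 1"
      using small by (rule order_tendstoD) simp
    have "\<forall>\<^sub>F n in sequentially. ?b n \<le> ?pr n"
      using G e1 e2
    proof eventually_elim
      case (elim n)
      define x where "x = p n * (real n)\<^sup>2"
      define w where "w = nat \<lceil>lam * x + 4 / \<alpha>\<rceil>"
      have "4 / \<alpha> > 0" using assms by simp
      have lx: "4 / \<alpha> + 1 + k \<le> lam * x"
        using elim(2) lam by (simp add: x_def divide_le_eq mult.commute)
      then have x0: "x \<ge> 0" using lam p by (simp add: x_def)
      have w1: "lam * x + 4 / \<alpha> \<le> real w" unfolding w_def by (rule real_nat_ceiling_ge)
      have "real w \<le> lam * x + 4 / \<alpha> + 1"
        unfolding w_def using lx \<open>4 / \<alpha> > 0\<close> by linarith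
      then have w2: "real w \<le> 2 * (lam * x)" using lx by linarith
      have "real C * real w \<le> real C * (2 * (lam * x))" using w2 by (intro mult_left_mono) auto
      also have "\<dots> = \<kappa> * x / 4" unfolding lam(2)[symmetric] by simp
      finally have Cw: "real C * real w \<le> \<kappa> * x / 4" .
      have l8: "8 * (lam * x) \<le> \<kappa> * x" using \<open>lam * 8 \<le> \<kappa>\<close> x0 mult_right_mono by fastforce
      have "x = real n * (p n * real n)" by (simp add: x_def power2_eq_square)
      also have "\<dots> \<le> real n" using elim(3) by (intro mult_left_le) auto
      finally have xn: "x \<le> real n" .
      have "\<kappa> * x \<le> \<alpha> / 64 * real n" using \<kappa> xn x0 assms by (intro mult_mono) auto
      have "0 \<le> \<kappa> * x" using \<kappa> x0 by simp
      have kx: "\<kappa> * x \<le> \<alpha> * real n / 64"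
        using \<open>\<kappa> * x \<le> \<alpha> / 64 * real n\<close> by simp
      have "\<alpha> * real n \<le> real n" using assms by (simp add: mult_left_le_one_le)
      have "real k \<le> real w" using w1 lx \<open>4 / \<alpha> > 0\<close> by linarith
      then have "(1 / 2 :: real) ^ w \<le> (1 / 2) ^ k" by (intro power_decreasing) auto
      then have wk: "(1 / 2) ^ w \<le> \<alpha> / 12" using k by linarith
      have "?pr n \<ge> 1 - (4 ^ (C * w) * exp (- (\<alpha>\<^sup>2 / 64) * (p n * (real n)\<^sup>2)) + 2 * (p n * real n) / (\<alpha>\<^sup>2 / 64))"
      proof (rule prob_discrepancy_ge)
        show "real (C * w) \<le> \<alpha> * real n / 2" using Cw kx \<open>0 \<le> \<kappa> * x\<close> by simp
        show "lam * p n * (real n)\<^sup>2 + 4 / \<alpha> \<le> real w" using w1 by (simp add: x_def mult.assoc)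
        show "real w \<le> \<alpha>\<^sup>2 / 64 * (p n * (real n)\<^sup>2) / 2"
          using w2 l8 lx \<open>4 / \<alpha> > 0\<close> unfolding \<kappa>_def x_def by linarith
        show "0 \<le> lam * p n * (real n)\<^sup>2" using lam p by simp
        \<comment> \<open>The left side is at most
          \<open>2 * lam * x \<le> \<kappa> * x / 4 \<le> \<alpha> * n / 256\<close>.\<close>
        have "lam * x + 4 / \<alpha> \<le> real n / 3"
          using lx l8 kx \<open>\<alpha> * real n \<le> real n\<close> by linarith
        then show "lam * p n * (real n)\<^sup>2 + 4 / \<alpha> \<le> real n / 3" by (simp add: x_def mult.assoc)
      qed (use assms p elim C wk in auto)
      moreover have "4 ^ (C * w) * exp (- \<kappa> * x) \<le> exp (- (\<kappa> / 2 * x))"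
      proof -
        have "(2::real) \<le> exp 1" using exp_ge_add_one_self[of 1] by simp
        then have "(2::real) ^ (2 * (C * w)) \<le> exp (1::real) ^ (2 * (C * w))" by (intro power_mono) auto
        also have "\<dots> = exp (real (2 * (C * w)))" by (simp only: exp_of_nat_mult[symmetric] mult_1_right)
        finally have "(4::real) ^ (C * w) \<le> exp (real (2 * (C * w)))"
          unfolding power_mult[of 2 2 "C * w"] by simp
        also have "\<dots> \<le> exp (\<kappa> * x / 2)" using Cw by simp
        finally have "4 ^ (C * w) * exp (- \<kappa> * x) \<le> exp (\<kappa> * x / 2) * exp (- \<kappa> * x)"
          by (intro mult_right_mono) auto
        also have "\<dots> = exp (- (\<kappa> / 2 * x))" by (simp add: exp_add[symmetric])
        finally show ?thesis .
      qed
      ultimately show "?b n \<le> ?pr n" unfolding \<kappa>_def x_def by linarith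
    qed
    moreover have "\<forall>\<^sub>F n in sequentially. ?pr n \<le> 1" by simp
    ultimately show "?pr \<longlonglongrightarrow> 1" using lim by (intro tendsto_sandwich[OF _ _ lim tendsto_const])
  qed (use lam in simp)
qed

end
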